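(* $\Lambda(\mathrm{PDS}_3)=\Pi_2\cup\Pi_3$.
   Context: A real matrix is doubly stochastic if its entries are nonnegative and every row and column sums to $1$. A matrix is permutative if every row is a permutation of its first row. $\mathrm{PDS}_n$ is the set of all $n\times n$ matrices that are both permutative and doubly stochastic. For a set $S$ of matrices, $\Lambda(S)\subseteq\mathbb{C}$ is the set of all complex numbers that are eigenvalues of some matrix in $S$. $\Pi_j\subseteq\mathbb{C}$ is the convex hull of the $j$-th roots of unity. *)

theory Defs
  imports "HOL-Analysis.Analysis" "HOL-Combinatorics.Permutations" "Jordan_Normal_Form.Char_Poly"
begin

definition doubly_stochastic :: "real mat \<Rightarrow> bool" where
  "doubly_stochastic A \<longleftrightarrow>
     (\<forall>i<dim_row A. \<forall>j<dim_col A. 0 \<le> A $$ (i, j)) \<and>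
     (\<forall>i<dim_row A. (\<Sum>j<dim_col A. A $$ (i, j)) = 1) \<and>
     (\<forall>j<dim_col A. (\<Sum>i<dim_row A. A $$ (i, j)) = 1)"

text \<open>The permutation may differ from row to row. Indices start at 0, so the first row is row 0.\<close>

definition permutative :: "real mat \<Rightarrow> bool" where
  "permutative A \<longleftrightarrow>
     (\<forall>i<dim_row A. \<exists>p. p permutes {..<dim_col A} \<and>
        (\<forall>j<dim_col A. A $$ (i, j) = A $$ (0, p j)))"

definition PDS :: "nat \<Rightarrow> real mat set" where
  "PDS n = {A \<in> carrier_mat n n. permutative A \<and> doubly_stochastic A}"

text \<open>Eigenvalues are complex, so the real matrices are viewed as complex ones.\<close>

definition Lambda_set :: "real mat set \<Rightarrow> complex set" where
  "Lambda_set S = {z. \<exists>A\<in>S. eigenvalue (map_mat complex_of_real A) z}"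

definition Pi_hull :: "nat \<Rightarrow> complex set" where
  "Pi_hull j = convex hull {z. z ^ j = 1}"

end

theory Submission
  imports Defs "HOL-Number_Theory.Cong"
begin

text \<open>
  Both inclusions rest on how a \<open>3 \<times> 3\<close> doubly stochastic matrix acts on the plane of vectors with
  entry sum zero, which carries every eigenvalue except \<open>1\<close>. Identify this plane with \<open>\<complex>\<close> through
  the discrete Fourier transform. The circulant part of the matrix acts as multiplication by a
  complex number \<open>\<alpha>\<close>, and the rest, whose entries depend only on the sum of the
  two indices modulo 3, acts as
  \<open>w \<mapsto> \<beta> * cnj w\<close>. The eigenvalues on the plane are thus
  \<open>Re \<alpha> \<plusminus> sqrt (\<bar>\<beta>\<bar>\<^sup>2 - (Im \<alpha>)\<^sup>2)\<close>.

  A real eigenvalue lies in \<open>[-1, 1] = \<Pi>\<^sub>2\<close> because the matrix contracts the \<open>l\<^sup>1\<close> norm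
  (\<open>doubly_stochastic_eigenvalue_norm_le_1\<close>). A nonreal eigenvalue \<open>z\<close> has \<open>Re z = Re \<alpha>\<close> and
  \<open>\<bar>Im z\<bar> \<le> \<bar>Im \<alpha>\<bar>\<close>. The nonnegative trace gives \<open>Re z \<ge> -1/2\<close>, one side of the triangle
  \<open>\<Pi>\<^sub>3\<close>; the other two sides are the bound on \<open>\<bar>Im \<alpha>\<bar>\<close> that follows from nonnegativity of the
  off-diagonal entries (\<open>doubly_stochastic_3_eigenvalue\<close>).

  Conversely, a circulant matrix with weights \<open>a, b, c\<close> is permutative and has the eigenvalue
  \<open>a + b * \<omega> + c * \<omega>\<^sup>2\<close>, so all of \<open>\<Pi>\<^sub>3\<close> occurs. This covers \<open>[-1/2, 1]\<close>; the
  remaining points of \<open>\<Pi>\<^sub>2\<close> are eigenvalues of symmetric matrices whose rows shift in the opposite direction.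
\<close>

section \<open>Eigenvalues in coordinates\<close>

lemma eigenvalue_map_of_real_iff:
  assumes A: "A \<in> carrier_mat n n"
  shows "eigenvalue (map_mat complex_of_real A) z \<longleftrightarrow>
    (\<exists>v. (\<exists>i<n. v i \<noteq> 0) \<and> (\<forall>i<n. (\<Sum>j<n. of_real (A $$ (i, j)) * v j) = z * v i))"
    (is "?L \<longleftrightarrow> ?R")
proof
  assume ?L
  then obtain v where v: "v \<in> carrier_vec n" "v \<noteq> 0\<^sub>v n"
      and Av: "map_mat complex_of_real A *\<^sub>v v = z \<cdot>\<^sub>v v"
    using A by (auto simp: eigenvalue_def eigenvector_def)
  have "\<exists>i<n. vec_index v i \<noteq> 0"
    using v by (metis carrier_vecD eq_vecI index_zero_vec(1) index_zero_vec(2))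
  moreover have "(\<Sum>j<n. of_real (A $$ (i, j)) * vec_index v j) = z * vec_index v i" if i: "i < n" for i
  proof -
    have "vec_index (map_mat complex_of_real A *\<^sub>v v) i = vec_index (z \<cdot>\<^sub>v v) i"
      by (simp only: Av)
    then show ?thesis
      using A v i by (simp add: scalar_prod_def atLeast0LessThan)
  qed
  ultimately show ?R
    by (intro exI[of _ "vec_index v"]) auto
next
  assume ?R
  then obtain v where v: "\<exists>i<n. v i \<noteq> 0"
      and e: "\<And>i. i < n \<Longrightarrow> (\<Sum>j<n. of_real (A $$ (i, j)) * v j) = z * v i"
    by auto
  have "eigenvector (map_mat complex_of_real A) (vec n v) z"
    unfolding eigenvector_def
  proof (intro conjI)
    show "vec n v \<noteq> 0\<^sub>v (dim_row (map_mat complex_of_real A))"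
    proof
      assume "vec n v = 0\<^sub>v (dim_row (map_mat complex_of_real A))"
      then have "vec n v = 0\<^sub>v n" using A by simp
      then have "\<forall>i<n. v i = 0" by (metis index_vec index_zero_vec(1))
      with v show False by auto
    qed
    show "map_mat complex_of_real A *\<^sub>v vec n v = z \<cdot>\<^sub>v vec n v"
      using A e by (intro eq_vecI) (auto simp: scalar_prod_def atLeast0LessThan)
  qed (use A in auto)
  then show ?L by (auto simp: eigenvalue_def)
qed

text \<open>Column sums equal to one make the matrix a contraction for the \<open>l\<^sup>1\<close> norm.\<close>

lemma doubly_stochastic_eigenvalue_norm_le_1:
  assumes A: "A \<in> carrier_mat n n" and ds: "doubly_stochastic A"
    and ev: "eigenvalue (map_mat complex_of_real A) z"
  shows "norm z \<le> 1"
proof -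
  obtain v where v: "\<exists>i<n. v i \<noteq> 0"
      and e: "\<And>i. i < n \<Longrightarrow> (\<Sum>j<n. of_real (A $$ (i, j)) * v j) = z * v i"
    using ev eigenvalue_map_of_real_iff[OF A] by auto
  have nn: "\<And>i j. i < n \<Longrightarrow> j < n \<Longrightarrow> 0 \<le> A $$ (i, j)"
    and col: "\<And>j. j < n \<Longrightarrow> (\<Sum>i<n. A $$ (i, j)) = 1"
    using ds A by (auto simp: doubly_stochastic_def)
  have "norm z * (\<Sum>i<n. norm (v i)) = (\<Sum>i<n. norm (\<Sum>j<n. of_real (A $$ (i, j)) * v j))"
    by (simp add: sum_distrib_left e norm_mult)
  also have "\<dots> \<le> (\<Sum>i<n. \<Sum>j<n. A $$ (i, j) * norm (v j))"
    by (intro sum_mono order.trans[OF norm_sum]) (simp add: norm_mult nn)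
  also have "\<dots> = (\<Sum>j<n. (\<Sum>i<n. A $$ (i, j)) * norm (v j))"
    by (subst sum.swap) (simp add: sum_distrib_right)
  also have "\<dots> = (\<Sum>j<n. norm (v j))"
    by (simp add: col)
  finally have le: "norm z * (\<Sum>i<n. norm (v i)) \<le> 1 * (\<Sum>i<n. norm (v i))"
    by simp
  have "0 < (\<Sum>i<n. norm (v i))"
    using v by (metis finite_lessThan lessThan_iff norm_ge_zero sum_pos2 zero_less_norm_iff)
  with le show ?thesis
    by (meson mult_le_cancel_right_pos)
qed

lemma sum_lessThan_3: "(\<Sum>j<(3::nat). f j) = f 0 + f 1 + f 2"
  by (simp add: numeral_3_eq_3 numeral_2_eq_2)

lemma all_less_3_iff: "(\<forall>i<(3::nat). P i) \<longleftrightarrow> P 0 \<and> P 1 \<and> P 2"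
  by (auto simp: numeral_3_eq_3 numeral_2_eq_2 less_Suc_eq)

section \<open>The hulls of the square and cube roots of unity\<close>

definition omega :: complex where
  "omega = Complex (-1/2) (sqrt 3 / 2)"

lemma omega_sq: "omega^2 = Complex (-1/2) (- sqrt 3 / 2)"
  by (simp add: omega_def power2_eq_square complex_eq_iff)

lemma omega_cube: "omega^3 = 1"
proof -
  have "omega^3 = omega * omega^2" by (simp add: power3_eq_cube power2_eq_square)
  also have "\<dots> = 1" by (simp add: omega_sq) (simp add: omega_def complex_eq_iff)
  finally show ?thesis .
qed

lemma cube_roots_of_unity: "{z::complex. z^3 = 1} = {1, omega, omega^2}"
proof -
  have sum: "omega + omega^2 = -1"
    by (simp add: omega_sq) (simp add: omega_def complex_eq_iff)
  have prod: "omega * omega^2 = 1"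
    using omega_cube by (simp add: power3_eq_cube power2_eq_square mult.assoc)
  have "z^3 = 1 \<longleftrightarrow> z = 1 \<or> z = omega \<or> z = omega^2" for z
  proof -
    have "(z - omega) * (z - omega^2) = z^2 - (omega + omega^2) * z + omega * omega^2"
      by (simp only: power2_eq_square algebra_simps)
    also have "\<dots> = z^2 + z + 1"
      unfolding sum prod by simp
    finally have "z^3 - 1 = (z - 1) * ((z - omega) * (z - omega^2))"
      by (simp add: power3_eq_cube power2_eq_square algebra_simps)
    then show ?thesis
      by (metis mult_eq_0_iff right_minus_eq)
  qed
  then show ?thesis by auto
qed

lemma mem_Pi_hull_2_iff: "z \<in> Pi_hull 2 \<longleftrightarrow> Im z = 0 \<and> \<bar>Re z\<bar> \<le> 1"
proof -
  have "{z::complex. z^2 = 1} = {-1, 1}" by (auto simp: power2_eq_1_iff)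
  then have "Pi_hull 2 = closed_segment (-1) 1"
    by (simp add: Pi_hull_def segment_convex_hull)
  moreover have "closed_segment (-1) (1::complex) = of_real ` closed_segment (-1) 1"
    using closed_segment_of_real[of "-1" 1] by simp
  ultimately show ?thesis
    by (auto simp: closed_segment_eq_real_ivl complex_eq_iff intro!: image_eqI[of _ _ "Re z"])
qed

lemma mem_Pi_hull_3_iff:
  "z \<in> Pi_hull 3 \<longleftrightarrow>
    (\<exists>a b c. 0 \<le> a \<and> 0 \<le> b \<and> 0 \<le> c \<and> a + b + c = 1 \<and>
       z = of_real a + of_real b * omega + of_real c * omega^2)"
  by (auto simp: Pi_hull_def cube_roots_of_unity convex_hull_3 scaleR_conv_of_real)

text \<open>The first inequality is the vertical side of the triangle, and the other two together give
  the slanted sides \<open>sqrt 3 * \<bar>Im z\<bar> \<le> 1 - Re z\<close>: they make the barycentric coordinates of \<open>z\<close>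
  with respect to the cube roots of unity nonnegative.\<close>

lemma Pi_hull_3I:
  assumes "- 1/2 \<le> Re z" "Re z \<le> 1" and im: "3 * (Im z)\<^sup>2 \<le> (1 - Re z)\<^sup>2"
  shows "z \<in> Pi_hull 3"
proof -
  have "\<bar>sqrt 3 * Im z\<bar> \<le> 1 - Re z"
    using im assms(2) abs_le_square_iff[of "sqrt 3 * Im z" "1 - Re z"] by (simp add: power_mult_distrib)
  then have "0 \<le> (1 - Re z + sqrt 3 * Im z) / 3" "0 \<le> (1 - Re z - sqrt 3 * Im z) / 3"
    "0 \<le> (1 + 2 * Re z) / 3"
    using assms by auto
  moreover have "z = of_real ((1 + 2 * Re z) / 3) + of_real ((1 - Re z + sqrt 3 * Im z) / 3) * omega
      + of_real ((1 - Re z - sqrt 3 * Im z) / 3) * omega^2"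
    unfolding omega_sq by (simp add: omega_def complex_eq_iff field_simps)
  moreover have "(1 + 2 * Re z) / 3 + (1 - Re z + sqrt 3 * Im z) / 3 + (1 - Re z - sqrt 3 * Im z) / 3 = 1"
    by (simp add: field_simps)
  ultimately show ?thesis
    unfolding mem_Pi_hull_3_iff by blast
qed

section \<open>Locating the eigenvalues\<close>

lemma nonreal_root_of_real_quadratic:
  fixes z :: complex and t d :: real
  assumes eq: "z^2 - of_real t * z + of_real d = 0" and im: "Im z \<noteq> 0"
  shows "2 * Re z = t" and "(Im z)\<^sup>2 = d - t\<^sup>2 / 4"
proof -
  have "Im (z^2 - of_real t * z + of_real d) = 0" "Re (z^2 - of_real t * z + of_real d) = 0"
    by (simp_all only: eq zero_complex.sel)
  then have i: "Im z * (2 * Re z - t) = 0" and r: "(Re z)\<^sup>2 - (Im z)\<^sup>2 - t * Re z + d = 0"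
    by (simp_all add: power2_eq_square algebra_simps)
  from i im show t: "2 * Re z = t" by simp
  show "(Im z)\<^sup>2 = d - t\<^sup>2 / 4"
    using r unfolding t[symmetric] by (simp add: power2_eq_square algebra_simps)
qed

text \<open>For a nonreal eigenvalue the sum-zero plane reduces the problem to a quadratic with real
  coefficients, whose roots have real part \<open>(trace A - 1) / 2\<close> and whose discriminant is
  controlled by the skew-symmetric part of \<open>A\<close>.\<close>

lemma doubly_stochastic_3_eigenvalue:
  assumes A: "A \<in> carrier_mat 3 3" and ds: "doubly_stochastic A"
    and ev: "eigenvalue (map_mat complex_of_real A) z"
  shows "z \<in> Pi_hull 2 \<union> Pi_hull 3"
proof (cases "Im z = 0")
  case True
  then show ?thesis
    using doubly_stochastic_eigenvalue_norm_le_1[OF A ds ev] abs_Re_le_cmod[of z]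
    by (auto simp: mem_Pi_hull_2_iff)
next
  case im: False
  define a where "a = A $$ (0,0)"
  define b where "b = A $$ (0,1)"
  define d where "d = A $$ (1,0)"
  define e where "e = A $$ (1,1)"
  have rows: "\<forall>i<3. (\<Sum>j<3. A $$ (i,j)) = 1" and cols: "\<forall>j<3. (\<Sum>i<3. A $$ (i,j)) = 1"
    and nn: "\<forall>i<3. \<forall>j<3. 0 \<le> A $$ (i,j)"
    using A ds by (auto simp: doubly_stochastic_def)
  have ents: "A $$ (0,2) = 1 - a - b" "A $$ (1,2) = 1 - d - e" "A $$ (2,0) = 1 - a - d"
    "A $$ (2,1) = 1 - b - e" "A $$ (2,2) = a + b + d + e - 1"
    using rows cols unfolding all_less_3_iff sum_lessThan_3 a_def b_def d_def e_def by linarith+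
  have pos: "0 \<le> a" "0 \<le> b" "0 \<le> d" "0 \<le> e" "a + b \<le> 1" "d + e \<le> 1" "a + d \<le> 1" "b + e \<le> 1"
    "1 \<le> a + b + d + e"
    using nn unfolding all_less_3_iff ents a_def[symmetric] b_def[symmetric] d_def[symmetric] e_def[symmetric]
    by auto
  obtain v where v: "\<exists>i<3. v i \<noteq> 0"
      and ev': "\<forall>i<3. (\<Sum>j<3. of_real (A $$ (i, j)) * v j) = z * v i"
    using ev eigenvalue_map_of_real_iff[OF A] by auto
  define x where "x = v 0"
  define y where "y = v 1"
  have eqs: "of_real a * x + of_real b * y + of_real (1 - a - b) * v 2 = z * x"
     "of_real d * x + of_real e * y + of_real (1 - d - e) * v 2 = z * y"
     "of_real (1 - a - d) * x + of_real (1 - b - e) * y + of_real (a + b + d + e - 1) * v 2 = z * v 2"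
    using ev' unfolding all_less_3_iff sum_lessThan_3 ents
      a_def[symmetric] b_def[symmetric] d_def[symmetric] e_def[symmetric] x_def y_def
    by blast+
  \<comment> \<open>Adding the three equations uses the column sums: \<open>z\<close> fixes the sum of the entries of the
    eigenvector, which must therefore vanish unless \<open>z = 1\<close>.\<close>
  have zsum: "x + y + v 2 = z * x + z * y + z * v 2"
    unfolding eqs[symmetric] by (simp add: algebra_simps)
  have "(z - 1) * (x + y + v 2) = (z * x + z * y + z * v 2) - (x + y + v 2)"
    by (simp add: left_diff_distrib distrib_left)
  then have "(z - 1) * (x + y + v 2) = 0"
    using zsum by simp
  moreover have "z \<noteq> 1" using im by auto
  ultimately have "x + y + v 2 = 0" by simp
  then have v2: "v 2 = - x - y"
    using add.inverse_unique[of "x + y" "v 2"] by simp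
  have xy: "x \<noteq> 0 \<or> y \<noteq> 0"
  proof (rule ccontr)
    assume "\<not> ?thesis"
    then have "\<forall>i<3. v i = 0" unfolding all_less_3_iff using v2 by (simp add: x_def y_def)
    with v show False by auto
  qed
  \<comment> \<open>Substituting \<open>v 2 = - x - y\<close> leaves the \<open>2 \<times> 2\<close> matrix with rows \<open>(p, q)\<close> and \<open>(r, s)\<close>;
    it is singular after subtracting \<open>z\<close> from its diagonal.\<close>
  define p where "p = 2 * a + b - 1"
  define q where "q = a + 2 * b - 1"
  define r where "r = 2 * d + e - 1"
  define s where "s = d + 2 * e - 1"
  have xeq: "(z - of_real p) * x = of_real q * y" and yeq: "(z - of_real s) * y = of_real r * x"
    unfolding left_diff_distrib eqs(1,2)[symmetric] v2 p_def q_def r_def s_def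
    by (simp_all add: algebra_simps)
  have "(z - of_real p) * (z - of_real s) * x = (z - of_real s) * ((z - of_real p) * x)"
    by (simp only: mult_ac)
  also have "\<dots> = of_real q * ((z - of_real s) * y)"
    unfolding xeq by (simp only: mult_ac)
  also have "\<dots> = of_real q * of_real r * x"
    unfolding yeq by (simp only: mult_ac)
  finally have "(z - of_real p) * (z - of_real s) * x = of_real q * of_real r * x" .
  moreover have "(z - of_real p) * (z - of_real s) * y = (z - of_real p) * ((z - of_real s) * y)"
    by (simp only: mult_ac)
  then have "(z - of_real p) * (z - of_real s) * y = of_real r * ((z - of_real p) * x)"
    unfolding yeq by (simp only: mult_ac)
  then have "(z - of_real p) * (z - of_real s) * y = of_real q * of_real r * y"
    unfolding xeq by (simp only: mult_ac)
  ultimately have "((z - of_real p) * (z - of_real s) - of_real q * of_real r) * x = 0"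
       "((z - of_real p) * (z - of_real s) - of_real q * of_real r) * y = 0"
    by (simp_all add: left_diff_distrib)
  then have "(z - of_real p) * (z - of_real s) - of_real q * of_real r = 0"
    using xy by auto
  then have quad: "z^2 - of_real (p + s) * z + of_real (p * s - q * r) = 0"
    by (simp add: power2_eq_square algebra_simps)
  note root = nonreal_root_of_real_quadratic[OF quad im]
  \<comment> \<open>The sums \<open>r0\<close>, \<open>r1\<close>, \<open>r2\<close> collect the entries whose index sum is 0, 1, 2 modulo 3. In the
    identity below, \<open>3/4 * (b - d)\<^sup>2\<close> is \<open>(Im \<alpha>)\<^sup>2\<close> for the circulant part \<open>\<alpha>\<close>, and the
    subtracted sum of squares is \<open>\<bar>r0 + r1 * \<omega> + r2 * \<omega>\<^sup>2\<bar>\<^sup>2 / 9 = \<bar>\<beta>\<bar>\<^sup>2\<close>.\<close>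
  define r0 where "r0 = a + (1 - d - e) + (1 - b - e)"
  define r1 where "r1 = b + d + (a + b + d + e - 1)"
  define r2 where "r2 = (1 - a - b) + (1 - a - d) + e"
  have "(p * s - q * r) - (p + s)\<^sup>2 / 4
      = 3/4 * (b - d)\<^sup>2 - ((2 * r0 - r1 - r2)\<^sup>2 + 3 * (r1 - r2)\<^sup>2) / 36"
    unfolding p_def q_def r_def s_def r0_def r1_def r2_def power2_eq_square by (simp add: field_simps)
  moreover have "0 \<le> ((2 * r0 - r1 - r2)\<^sup>2 + 3 * (r1 - r2)\<^sup>2) / 36"
    by simp
  ultimately have "(Im z)\<^sup>2 \<le> 3/4 * (b - d)\<^sup>2"
    unfolding root(2) by (metis diff_ge_0_iff_ge diff_diff_eq2 add_diff_cancel_left')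
  then have "3 * (Im z)\<^sup>2 \<le> 3 * (3/4 * (b - d)\<^sup>2)"
    by (rule mult_left_mono) simp
  also have "\<dots> = (3/2 * (b - d))\<^sup>2"
    unfolding power_mult_distrib by (simp add: power2_eq_square)
  also have "(3/2 * (b - d))\<^sup>2 \<le> (1 - Re z)\<^sup>2"
  proof -
    \<comment> \<open>The difference between the two cyclic off-diagonal sums is \<open>3 * (b - d)\<close>; their total is
      \<open>3 - trace A = 2 * (1 - Re z)\<close>, and both are nonnegative.\<close>
    have "\<bar>3/2 * (b - d)\<bar> \<le> 1 - Re z"
      using root(1) pos unfolding p_def s_def by auto
    then show ?thesis by (metis abs_ge_zero power2_abs power_mono)
  qed
  finally have "z \<in> Pi_hull 3"
    using root(1) pos unfolding p_def s_def by (intro Pi_hull_3I) auto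
  then show ?thesis by simp
qed

section \<open>Realising the hulls\<close>

text \<open>For \<open>k = 2\<close>, which is \<open>-1\<close> modulo 3, this is the circulant matrix with first row \<open>r\<close>; for
  \<open>k = 1\<close> the rows shift in the opposite direction and the matrix is symmetric.\<close>

definition shift_mat :: "nat \<Rightarrow> (nat \<Rightarrow> real) \<Rightarrow> real mat" where
  "shift_mat k r = mat 3 3 (\<lambda>(i, j). r ((j + k * i) mod 3))"

lemma shift_mat_dim [simp]: "dim_row (shift_mat k r) = 3" "dim_col (shift_mat k r) = 3"
  by (simp_all add: shift_mat_def)

lemma shift_mat_index: "i < 3 \<Longrightarrow> j < 3 \<Longrightarrow> shift_mat k r $$ (i, j) = r ((j + k * i) mod 3)"
  by (simp add: shift_mat_def)

lemma shift_mat_PDS: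
  assumes k: "k = 1 \<or> k = 2" and r: "0 \<le> r 0" "0 \<le> r 1" "0 \<le> r 2" "r 0 + r 1 + r 2 = 1"
  shows "shift_mat k r \<in> PDS 3"
proof -
  have "permutative (shift_mat k r)"
    unfolding permutative_def
  proof (intro allI impI)
    fix i assume i: "i < dim_row (shift_mat k r)"
    define p where "p j = (if j < 3 then (j + k * i) mod 3 else j)" for j
    have "inj_on p {..<3}"
    proof (rule inj_onI)
      fix x y assume "x \<in> {..<3}" "y \<in> {..<3}" "p x = p y"
      then have "x < 3" "y < 3" and eq: "(x + k * i) mod 3 = (y + k * i) mod 3"
        by (auto simp: p_def)
      have "x mod 3 = y mod 3"
        using eq cong_add_rcancel_nat[of x "k * i" y 3] by (simp add: cong_def)
      with \<open>x < 3\<close> \<open>y < 3\<close> show "x = y" by simp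
    qed
    then have "bij_betw p {..<3} {..<3}"
      by (intro bij_betw_imageI endo_inj_surj) (auto simp: p_def)
    then have "p permutes {..<dim_col (shift_mat k r)}"
      by (intro bij_imp_permutes) (auto simp: p_def shift_mat_def)
    moreover have "\<forall>j<dim_col (shift_mat k r). shift_mat k r $$ (i, j) = shift_mat k r $$ (0, p j)"
      using i by (auto simp: shift_mat_def p_def)
    ultimately show "\<exists>p. p permutes {..<dim_col (shift_mat k r)} \<and>
        (\<forall>j<dim_col (shift_mat k r). shift_mat k r $$ (i, j) = shift_mat k r $$ (0, p j))"
      by blast
  qed
  moreover have "doubly_stochastic (shift_mat k r)"
    unfolding doubly_stochastic_def shift_mat_dim all_less_3_iff sum_lessThan_3
    using k r by (elim disjE) (simp_all add: shift_mat_index numeral_2_eq_2 add_ac)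
  ultimately show ?thesis
    by (auto simp: PDS_def shift_mat_def)
qed

text \<open>The vector of powers of \<open>\<omega>\<close> is an eigenvector of every circulant matrix; the eigenvalue
  is the convex combination of cube roots of unity whose weights are the first row.\<close>

lemma Pi_hull_3_subset: "Pi_hull 3 \<subseteq> Lambda_set (PDS 3)"
proof
  fix z assume "z \<in> Pi_hull 3"
  then obtain a b c where abc: "0 \<le> a" "0 \<le> b" "0 \<le> c" "a + b + c = 1"
      and z: "z = of_real a + of_real b * omega + of_real c * omega^2"
    by (auto simp: mem_Pi_hull_3_iff)
  define A where "A = shift_mat 2 (nth [a, b, c])"
  have "A \<in> PDS 3"
    using abc unfolding A_def by (intro shift_mat_PDS) auto
  moreover have "eigenvalue (map_mat complex_of_real A) z"
  proof (subst eigenvalue_map_of_real_iff[of _ 3])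
    show "A \<in> carrier_mat 3 3" by (simp add: A_def shift_mat_def)
    show "\<exists>v. (\<exists>i<3. v i \<noteq> 0) \<and> (\<forall>i<3. (\<Sum>j<3. of_real (A $$ (i, j)) * v j) = z * v i)"
    proof (intro exI[of _ "\<lambda>j. omega ^ j"] conjI)
      show "\<exists>i<3. omega ^ i \<noteq> 0" by (intro exI[of _ 0]) simp
      have "omega * omega = omega^2" "omega^2 * omega = 1" "omega * omega^2 = 1" "omega^2 * omega^2 = omega"
        using omega_cube by (simp_all add: power3_eq_cube power2_eq_square mult.assoc)
      then show "\<forall>i<3. (\<Sum>j<3. of_real (A $$ (i, j)) * omega ^ j) = z * omega ^ i"
        unfolding all_less_3_iff sum_lessThan_3 A_def z
        by (simp add: shift_mat_index distrib_right mult.assoc)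
    qed
  qed
  ultimately show "z \<in> Lambda_set (PDS 3)" by (auto simp: Lambda_set_def)
qed

text \<open>From \<open>-1/2\<close> on the segment runs inside the triangle \<open>\<Pi>\<^sub>3\<close>. To the left of it a first row
  \<open>(u, w, u)\<close> with the rows shifting to the left suffices: \<open>(1, -1, 0)\<close> is an eigenvector with
  eigenvalue \<open>u - w\<close>, which falls from \<open>1/2\<close> to \<open>-1\<close> as \<open>w\<close> grows from 0 to 1.\<close>

lemma Pi_hull_2_subset: "Pi_hull 2 \<subseteq> Lambda_set (PDS 3)"
proof
  fix z assume z2: "z \<in> Pi_hull 2"
  show "z \<in> Lambda_set (PDS 3)"
  proof (cases "Re z \<ge> -1/2")
    case True
    then have "z \<in> Pi_hull 3"
      using z2 by (intro Pi_hull_3I) (auto simp: mem_Pi_hull_2_iff)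
    then show ?thesis using Pi_hull_3_subset by auto
  next
    case False
    define x where "x = Re z"
    have z: "z = of_real x" and x: "-1 \<le> x" "x < -1/2"
      using z2 False by (auto simp: mem_Pi_hull_2_iff x_def complex_eq_iff)
    \<comment> \<open>The solution of \<open>2 * u + w = 1\<close> and \<open>u - w = x\<close>.\<close>
    define A where "A = shift_mat 1 (nth [(1 + x) / 3, (1 - 2 * x) / 3, (1 + x) / 3])"
    have "A \<in> PDS 3"
      using x unfolding A_def by (intro shift_mat_PDS) (auto simp: field_simps)
    moreover have "eigenvalue (map_mat complex_of_real A) z"
    proof (subst eigenvalue_map_of_real_iff[of _ 3])
      show "A \<in> carrier_mat 3 3" by (simp add: A_def shift_mat_def)
      show "\<exists>v. (\<exists>i<3. v i \<noteq> 0) \<and> (\<forall>i<3. (\<Sum>j<3. of_real (A $$ (i, j)) * v j) = z * v i)"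
        unfolding all_less_3_iff sum_lessThan_3 A_def shift_mat_def z
        by (intro exI[of _ "nth [1, -1, 0]"] conjI exI[of _ 0]) (auto simp: complex_eq_iff field_simps)
    qed
    ultimately show ?thesis by (auto simp: Lambda_set_def)
  qed
qed

theorem theorem3p1:
  shows "Lambda_set (PDS 3) = Pi_hull 2 \<union> Pi_hull 3"
proof
  show "Lambda_set (PDS 3) \<subseteq> Pi_hull 2 \<union> Pi_hull 3"
    using doubly_stochastic_3_eigenvalue by (auto simp: Lambda_set_def PDS_def)
  show "Pi_hull 2 \<union> Pi_hull 3 \<subseteq> Lambda_set (PDS 3)"
    using Pi_hull_2_subset Pi_hull_3_subset by simp
qed

end
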